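(* Let $\mathcal{A}$ be a locally-complex algebra of dimension $\dim \mathcal{A} = n > 2$. Then the length $l(\mathcal{A})$ of $\mathcal{A}$ is less than or equal to the $(n-1)$-th Fibonacci number $F_{n-1}$.
   Context: All algebras are unital, finite-dimensional and not necessarily associative. A locally-complex algebra is such an algebra $\mathcal{A}$ over $\mathbb{R}$ with the property that every subalgebra of $\mathcal{A}$ generated by one element of $\mathcal{A}\setminus \mathbb{R}$ is isomorphic to $\mathbb{C}$ (here $\mathbb{R}$ is identified with $\mathbb{R}\cdot 1 \subseteq \mathcal{A}$). Let $\mathcal{S}$ be a finite subset of $\mathcal{A}$. For $i\ge 1$, a word in $\mathcal{S}$ of length $i$ is a product of $i$ elements of $\mathcal{S}$ (repetitions allowed) with some arrangement of brackets; different arrangements of brackets give different words of the same length. The element $1$ is regarded as a word of length $0$. For $i \ge 0$, $\mathcal{L}_i(\mathcal{S})$ is the linear span of (the values in $\mathcal{A}$ of) all words in $\mathcal{S}$ of length at most $i$; in particular $\mathcal{L}_0(\mathcal{S}) = \mathbb{R}\cdot 1$. Put $\mathcal{L}(\mathcal{S}) = \bigcup_{i\ge 0}\mathcal{L}_i(\mathcal{S})$. The set $\mathcal{S}$ is a generating set of $\mathcal{A}$ if $\mathcal{L}(\mathcal{S}) = \mathcal{A}$. The length of a generating set $\mathcal{S}$ is $l(\mathcal{S}) = \min\{k \in \mathbb{Z}_{\ge 0} : \mathcal{L}_k(\mathcal{S}) = \mathcal{A}\}$, and the length of the algebra is $l(\mathcal{A}) = \max\{ l(\mathcal{S}) : \mathcal{S}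 \text{ finite}, \ \mathcal{L}(\mathcal{S}) = \mathcal{A}\}$. The Fibonacci numbers are defined by $F_1 = F_2 = 1$ and $F_i = F_{i-1}+F_{i-2}$ for $i \ge 3$. *)

theory Defs
  imports "HOL-Analysis.Linear_Algebra" "HOL-Number_Theory.Fib"
begin

text \<open>
  The library's algebra type classes are associative, so the product and the unit are
  locale parameters on a real vector space.
\<close>

locale unital_algebra =
  fixes mult :: "'a::real_vector \<Rightarrow> 'a \<Rightarrow> 'a"  (infixl "\<odot>" 70)
    and one :: 'a  ("\<one>")
  assumes bilinear_mult: "bilinear (\<odot>)"
    and one_left: "\<one> \<odot> x = x"
    and one_right: "x \<odot> \<one> = x"
    and finite_dimensional: "\<exists>B::'a set. finite B \<and> span B = UNIV"

datatype 'a word = Letter 'a | Prod "'a word" "'a word"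

primrec word_length :: "'a word \<Rightarrow> nat" where
  "word_length (Letter a) = 1"
| "word_length (Prod u v) = word_length u + word_length v"

context unital_algebra
begin

definition subalgebra :: "'a set \<Rightarrow> bool" where
  "subalgebra B \<longleftrightarrow> subspace B \<and> \<one> \<in> B \<and> (\<forall>x\<in>B. \<forall>y\<in>B. x \<odot> y \<in> B)"

definition iso_complex :: "'a set \<Rightarrow> bool" where
  "iso_complex B \<longleftrightarrow>
     (\<exists>f::complex \<Rightarrow> 'a. linear f \<and> f 1 = \<one> \<and> (\<forall>z w. f (z * w) = f z \<odot> f w) \<and>
        bij_betw f UNIV B)"

primrec word_value :: "'a word \<Rightarrow> 'a" where
  "word_value (Letter a) = a"
| "word_value (Prod u v) = word_value u \<odot> word_value v"

text \<open>
  The datatype has no word of length 0; the unit, which plays that role, is adjoined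
  explicitly.
\<close>

definition words_span :: "nat \<Rightarrow> 'a set \<Rightarrow> 'a set" where
  "words_span i S =
     span (insert \<one> {word_value w |w. set_word w \<subseteq> S \<and> word_length w \<le> i})"

definition all_words_span :: "'a set \<Rightarrow> 'a set" where
  "all_words_span S = (\<Union>i. words_span i S)"

definition generating :: "'a set \<Rightarrow> bool" where
  "generating S \<longleftrightarrow> all_words_span S = UNIV"

text \<open>Only meaningful for generating sets; for other sets the LEAST is unspecified.\<close>

definition set_length :: "'a set \<Rightarrow> nat" where
  "set_length S = (LEAST k. words_span k S = UNIV)"

definition alg_length :: nat where
  "alg_length = Max {set_length S |S. finite S \<and> generating S}"

end

locale locally_complex_algebra = unital_algebra +
  assumes locally_complex: "a \<notin> range (\<lambda>r::real. r *\<^sub>R \<one>) \<Longrightarrow> iso_complex (subalgebra hull {a})"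

end

theory Submission
  imports Defs
begin

text \<open>
  Local complexity enters through the fact that every square \<open>x \<odot> x\<close> lies in the span of \<open>\<one>\<close> and
  \<open>x\<close>.  Write \<open>L i\<close> for the span of the words of length at most \<open>i\<close>; these spaces
  grow with \<open>i\<close>, and \<open>L i \<odot> L j \<subseteq> L (i + j)\<close>.

  Let \<open>j \<le> k\<close> with \<open>k \<ge> 1\<close>, and suppose that \<open>L k\<close> has dimension at least \<open>h + 1\<close> while \<open>L j\<close> has
  dimension at least \<open>h\<close>.  If \<open>L (k + j)\<close> still has dimension at most \<open>h + 1\<close>, then it equals \<open>L k\<close>,
  and \<open>L k\<close> is spanned by \<open>L j\<close> together with one further vector \<open>x\<close>.  A product of two elements of
  \<open>L k\<close> is then a combination of products with a factor in \<open>L j\<close>, which lie in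
  \<open>L (k + j) = L k\<close>, and of the square of \<open>x\<close>, which lies in \<open>L k\<close> because of the quadratic
  condition.  So \<open>L k\<close> is a subalgebra containing the generators, that is, the whole algebra.
  Thus, until the algebra is exhausted, each gain of one dimension costs at most the sum of the
  lengths needed for the two preceding dimensions (\<open>dim_words_span_step\<close>).  This is
  the Fibonacci recursion, and it starts with \<open>dim (L 0) = 1\<close> at length \<open>fib 0 = 0\<close>:
  unless \<open>L (fib h)\<close> is the whole algebra, its dimension is at least \<open>h + 1\<close>.  In an algebra of
  dimension \<open>n\<close> it is therefore the whole algebra for \<open>h = n - 1\<close>.
\<close>

lemma complex_square_eq:
  fixes z :: complex
  shows "z * z = (2 * Re z) *\<^sub>R z - ((Re z)\<^sup>2 + (Im z)\<^sup>2) *\<^sub>R 1"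
  by (simp add: complex_eq_iff power2_eq_square)

text \<open>
  The quadratic relation of a non-scalar element is the one of its preimage \<open>z\<close> in the complex
  numbers, where \<open>z\<^sup>2 = 2 Re z \<cdot> z - \<bar>z\<bar>\<^sup>2\<close>.
\<close>

lemma (in locally_complex_algebra) square_in_span:
  "x \<odot> x \<in> span {\<one>, x}"
proof (cases "x \<in> range (\<lambda>r::real. r *\<^sub>R \<one>)")
  case True
  then obtain r where r: "x = r *\<^sub>R \<one>" by blast
  have "x \<odot> x = r *\<^sub>R (\<one> \<odot> x)"
    by (subst r, rule bilinear_lmul[OF bilinear_mult])
  then show ?thesis by (simp add: one_left span_base span_scale)
next
  case False
  then obtain f :: "complex \<Rightarrow> 'a" where f: "linear f" "f 1 = \<one>"
    "\<And>z w. f (z * w) = f z \<odot> f w" "bij_betw f UNIV (subalgebra hull {x})"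
    using locally_complex unfolding iso_complex_def by blast
  have "x \<in> subalgebra hull {x}" by (simp add: hull_inc)
  then obtain z where z: "x = f z"
    using f(4) unfolding bij_betw_def by blast
  have "x \<odot> x = f (z * z)" by (simp add: f(3) z)
  also have "\<dots> = (2 * Re z) *\<^sub>R x - ((Re z)\<^sup>2 + (Im z)\<^sup>2) *\<^sub>R \<one>"
    unfolding complex_square_eq[of z] z
    by (simp only: linear_diff[OF f(1)] linear_scale[OF f(1)] f(2))
  finally show ?thesis by (simp add: span_base span_scale span_diff)
qed

context unital_algebra
begin

lemma mult_in_subspace_if_spanning:
  assumes "subspace V" and "\<And>a b. a \<in> A \<Longrightarrow> b \<in> B \<Longrightarrow> a \<odot> b \<in> V"
    and "x \<in> span A" and "y \<in> span B"
  shows "x \<odot> y \<in> V"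
proof -
  have sub_left: "subspace {u. u \<odot> v \<in> V}" for v
    using linear_subspace_vimage[OF _ assms(1), of "\<lambda>u. u \<odot> v"] bilinear_mult
    by (auto simp: bilinear_def vimage_def)
  have sub_right: "subspace {v. u \<odot> v \<in> V}" for u
    using linear_subspace_vimage[OF _ assms(1), of "\<lambda>v. u \<odot> v"] bilinear_mult
    by (auto simp: bilinear_def vimage_def)
  have "a \<odot> y \<in> V" if "a \<in> A" for a
    using span_minimal[OF _ sub_right, of B a] assms(2,4) that by blast
  then show ?thesis
    using span_minimal[OF _ sub_left, of A y] assms(3) by blast
qed

lemma subspace_words_span: "subspace (words_span i S)"
  by (simp add: words_span_def)

lemma one_in_words_span: "\<one> \<in> words_span i S"
  by (simp add: words_span_def span_base)

lemma word_value_in_words_span: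
  "set_word w \<subseteq> S \<Longrightarrow> word_length w \<le> i \<Longrightarrow> word_value w \<in> words_span i S"
  unfolding words_span_def by (rule span_base) blast

lemma words_span_mono: "i \<le> j \<Longrightarrow> words_span i S \<subseteq> words_span j S"
  unfolding words_span_def by (rule span_mono) auto

lemma mult_words_span:
  assumes "x \<in> words_span i S" and "y \<in> words_span j S"
  shows "x \<odot> y \<in> words_span (i + j) S"
proof (rule mult_in_subspace_if_spanning[OF subspace_words_span])
  fix a b
  assume a: "a \<in> insert \<one> {word_value w |w. set_word w \<subseteq> S \<and> word_length w \<le> i}"
    and b: "b \<in> insert \<one> {word_value w |w. set_word w \<subseteq> S \<and> word_length w \<le> j}"
  show "a \<odot> b \<in> words_span (i + j) S"
  proof (cases "a = \<one> \<or> b = \<one>")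
    case True
    have "a \<in> words_span (i + j) S" "b \<in> words_span (i + j) S"
      using a b by (auto intro: one_in_words_span word_value_in_words_span)
    with True show ?thesis by (auto simp: one_left one_right)
  next
    case False
    then obtain v w where "a = word_value v" "set_word v \<subseteq> S" "word_length v \<le> i"
      and "b = word_value w" "set_word w \<subseteq> S" "word_length w \<le> j"
      using a b by auto
    then show ?thesis
      using word_value_in_words_span[of "Prod v w" S "i + j"] by simp
  qed
qed (use assms in \<open>simp_all add: words_span_def\<close>)

lemma UNIV_if_subalgebra_of_generating:
  assumes "subalgebra B" and "S \<subseteq> B" and "generating S"
  shows "B = UNIV"
proof -
  have "word_value w \<in> B" if "set_word w \<subseteq> S" for w
    using that by (induction w) (use assms in \<open>auto simp: subalgebra_def\<close>)
  then have "words_span i S \<subseteq> B" for i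
    unfolding words_span_def
    by (intro span_minimal) (use assms(1) in \<open>auto simp: subalgebra_def\<close>)
  then show ?thesis
    using assms(3) unfolding generating_def all_words_span_def by blast
qed

lemma words_span_UNIV_if_mult_closed:
  assumes "generating S" and "k \<ge> 1"
    and "\<And>x y. x \<in> words_span k S \<Longrightarrow> y \<in> words_span k S \<Longrightarrow> x \<odot> y \<in> words_span k S"
  shows "words_span k S = UNIV"
proof (rule UNIV_if_subalgebra_of_generating[OF _ _ assms(1)])
  show "subalgebra (words_span k S)"
    by (simp add: subalgebra_def subspace_words_span one_in_words_span assms(3))
  show "S \<subseteq> words_span k S"
  proof
    fix a assume "a \<in> S"
    then show "a \<in> words_span k S"
      using word_value_in_words_span[of "Letter a" S k] assms(2) by simp
  qed
qed

lemma obtain_finite_basis: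
  obtains B :: "'a set" where "finite_dimensional_vector_space scaleR B"
proof -
  obtain C :: "'a set" where C: "finite C" "span C = UNIV"
    using finite_dimensional by blast
  obtain B where B: "B \<subseteq> C" "independent B" "C \<subseteq> span B"
    using maximal_independent_subset[of C] by blast
  have "span B = UNIV"
    using span_minimal[OF B(3) subspace_span] C(2) by blast
  then have "finite_dimensional_vector_space scaleR B"
    using B C finite_subset
    by unfold_locales (auto simp: dependent_raw_def span_raw_def)
  then show thesis by (rule that)
qed

lemma dim_mono:
  fixes V W :: "'a set"
  assumes "V \<subseteq> W"
  shows "dim V \<le> dim W"
proof -
  obtain B :: "'a set" where "finite_dimensional_vector_space scaleR B"
    by (rule obtain_finite_basis)
  then interpret fd: finite_dimensional_vector_space scaleR B .
  show ?thesis using fd.dim_subset[OF assms] by (simp add: dim_raw_def)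
qed

lemma subspace_eq_if_dim_le:
  fixes V W :: "'a set"
  assumes "subspace V" "subspace W" "V \<subseteq> W" "dim W \<le> dim V"
  shows "V = W"
proof -
  obtain B :: "'a set" where "finite_dimensional_vector_space scaleR B"
    by (rule obtain_finite_basis)
  then interpret fd: finite_dimensional_vector_space scaleR B .
  show ?thesis using fd.subspace_dim_equal[of V W] assms
    by (simp add: dim_raw_def subspace_raw_def)
qed

lemma subspace_eq_span_insert_if_codim_le_1:
  fixes V W :: "'a set"
  assumes "subspace V" "subspace W" "V \<subseteq> W" "dim W \<le> dim V + 1"
  obtains x where "x \<in> W" and "W = span (insert x V)"
proof (cases "V = W")
  case True
  then have "W = span (insert 0 V)"
    unfolding span_insert_0 using assms(2) span_eq_iff[of W] by blast
  then show thesis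
    using that[of 0] assms(2) subspace_0 by blast
next
  case False
  then obtain x where x: "x \<in> W" "x \<notin> V" using assms(3) by blast
  let ?U = "span (insert x V)"
  have sub: "?U \<subseteq> W"
    by (rule span_minimal) (use x assms in auto)
  have "V \<noteq> ?U" using x(2) span_base[of x "insert x V"] by auto
  moreover have "V \<subseteq> ?U" by (auto intro: span_base)
  ultimately have "dim V < dim ?U"
    using subspace_eq_if_dim_le[OF assms(1) subspace_span] by (meson not_le)
  then have "?U = W"
    using assms(4) by (intro subspace_eq_if_dim_le[OF subspace_span assms(2) sub]) simp
  then show thesis using that x(1) by blast
qed

text \<open>
  The contradiction comes from stability: if \<open>L (k + j)\<close> were no larger than \<open>L k\<close>, then \<open>L k\<close> would be
  closed under multiplication, because it is spanned by \<open>L j\<close> and one vector whose square is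
  controlled by the quadratic condition.  For \<open>j = 0\<close> the conclusion improves the bound on \<open>L k\<close> itself; with
  \<open>k = 1\<close> this shows that \<open>L 1\<close>, unless it is everything, has dimension at least 3, so that
  the recursion can start with \<open>fib 1 = fib 2 = 1\<close>.
\<close>

lemma dim_words_span_step:
  assumes quadratic: "\<And>x. x \<odot> x \<in> span {\<one>, x}"
    and gen: "generating S" and k: "k \<ge> 1" and jk: "j \<le> k"
    and dim_j: "dim (words_span j S) \<ge> h" and dim_k: "dim (words_span k S) \<ge> h + 1"
    and not_all: "words_span k S \<noteq> UNIV"
  shows "dim (words_span (k + j) S) \<ge> h + 2"
proof (rule ccontr)
  let ?L = "\<lambda>i. words_span i S"
  assume "\<not> ?thesis"
  then have small: "dim (?L (k + j)) \<le> h + 1" by simp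
  have stable: "?L k = ?L (k + j)"
    by (rule subspace_eq_if_dim_le) (use small dim_k in \<open>auto simp: subspace_words_span words_span_mono\<close>)
  have "dim (?L k) \<le> dim (?L j) + 1" using small dim_j stable by simp
  then obtain x where x: "x \<in> ?L k" and L_k: "?L k = span (insert x (?L j))"
    using subspace_eq_span_insert_if_codim_le_1[OF subspace_words_span subspace_words_span
        words_span_mono[OF jk]] by blast
  have xx: "x \<odot> x \<in> ?L k"
    using span_minimal[of "{\<one>, x}" "?L k"] x quadratic[of x] one_in_words_span
      subspace_words_span by blast
  have "y \<odot> z \<in> ?L k" if "y \<in> ?L k" "z \<in> ?L k" for y z
  proof (rule mult_in_subspace_if_spanning[OF subspace_words_span])
    fix a b assume ab: "a \<in> insert x (?L j)" "b \<in> insert x (?L j)"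
    then have in_L_k: "a \<in> ?L k" "b \<in> ?L k" using x words_span_mono[OF jk] by blast+
    consider "a = x" "b = x" | "a \<in> ?L j" | "b \<in> ?L j" using ab by blast
    then show "a \<odot> b \<in> ?L k"
    proof cases
      case 1
      then show ?thesis using xx by simp
    next
      case 2
      then show ?thesis
        using mult_words_span[of a j S b k] in_L_k by (subst stable) (simp add: add.commute)
    next
      case 3
      then show ?thesis
        using mult_words_span[of a k S b j] in_L_k by (subst stable) simp
    qed
  qed (use that in \<open>simp_all only: L_k[symmetric]\<close>)
  then have "?L k = UNIV" by (rule words_span_UNIV_if_mult_closed[OF gen k])
  with not_all show False by contradiction
qed

lemma words_span_fib:
  assumes quadratic: "\<And>x. x \<odot> x \<in> span {\<one>, x}"
    and gen: "generating S" and nonzero: "\<one> \<noteq> 0"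
  shows "words_span (fib h) S = UNIV \<or> dim (words_span (fib h) S) \<ge> h + 1"
proof (induction h rule: fib.induct)
  case 1
  have "dim {\<one>} = 1" using nonzero dim_eq_card_independent[of "{\<one>}"] by simp
  then show ?case
    using dim_mono[of "{\<one>}" "words_span (fib 0) S"] one_in_words_span by simp
next
  case 2
  have "dim {\<one>} = 1" using nonzero dim_eq_card_independent[of "{\<one>}"] by simp
  then have "dim (words_span 1 S) \<ge> 1"
    using dim_mono[of "{\<one>}" "words_span 1 S"] one_in_words_span by simp
  then show ?case
    using dim_words_span_step[OF quadratic gen, of 1 0 0] by fastforce
next
  case (3 h)
  have "fib h \<le> fib (Suc h)" by (rule fib_mono) simp
  moreover have "fib (Suc h) \<ge> 1" using fib_neq_0_nat[of "Suc h"] by simp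
  moreover have "words_span (fib h) S \<subseteq> words_span (fib (Suc h)) S"
    "words_span (fib (Suc h)) S \<subseteq> words_span (fib (Suc (Suc h))) S"
    by (auto intro!: words_span_mono fib_mono)
  ultimately show ?case
    using 3 dim_words_span_step[OF quadratic gen, of "fib (Suc h)" "fib h" "h + 1"]
    by (cases "words_span (fib (Suc h)) S = UNIV") auto
qed

lemma set_length_le_fib:
  assumes quadratic: "\<And>x. x \<odot> x \<in> span {\<one>, x}"
    and gen: "generating S" and dim: "dim (UNIV :: 'a set) = Suc m"
  shows "set_length S \<le> fib m"
proof -
  have "\<one> \<noteq> 0"
  proof
    assume "\<one> = 0"
    then have "x = 0" for x :: 'a
      using one_left[of x] bilinear_lzero[OF bilinear_mult, of x] by metis
    then have "(UNIV :: 'a set) = span {}" by auto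
    then have "dim (UNIV :: 'a set) = 0"
      using dim_eq_card_independent[OF independent_empty] dim_span[of "{} :: 'a set"]
      by (metis card.empty)
    with dim show False by simp
  qed
  from words_span_fib[OF quadratic gen this, of m] have "words_span (fib m) S = UNIV"
    using dim subspace_eq_if_dim_le[OF subspace_words_span subspace_UNIV, of "fib m" S] by auto
  then show ?thesis unfolding set_length_def by (rule Least_le)
qed

lemma generating_if_spanning:
  assumes "span S = UNIV"
  shows "generating S"
proof -
  have "S \<subseteq> words_span 1 S"
    using word_value_in_words_span[of "Letter _" S 1] by auto
  then have "words_span 1 S = UNIV"
    using span_minimal[OF _ subspace_words_span, of S 1 S] assms by blast
  then show ?thesis unfolding generating_def all_words_span_def by blast
qed

text \<open>
  The length of the algebra is a \<open>Max\<close>, which is meaningful only on a finite nonempty set: the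
  uniform bound makes the set of lengths finite, and a basis of the algebra is a generating set.
\<close>

lemma alg_length_le_fib:
  assumes "\<And>x. x \<odot> x \<in> span {\<one>, x}" and "dim (UNIV :: 'a set) = Suc m"
  shows "alg_length \<le> fib m"
proof -
  let ?M = "{set_length S |S. finite S \<and> generating S}"
  have bound: "l \<le> fib m" if "l \<in> ?M" for l
    using that set_length_le_fib[OF assms(1) _ assms(2)] by blast
  then have "finite ?M" by (intro finite_subset[OF _ finite_atMost[of "fib m"]]) blast
  moreover have "?M \<noteq> {}" using finite_dimensional generating_if_spanning by blast
  ultimately show ?thesis unfolding alg_length_def using bound by (intro Max.boundedI)
qed

end

theorem theorem6p3:
  fixes mult :: "'a::real_vector \<Rightarrow> 'a \<Rightarrow> 'a" and one :: 'a and n :: nat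
  assumes "locally_complex_algebra mult one"
    and "dim (UNIV :: 'a set) = n"
    and "n > 2"
  shows "unital_algebra.alg_length mult one \<le> fib (n - 1)"
proof -
  interpret locally_complex_algebra mult one by fact
  show ?thesis
    using alg_length_le_fib[OF square_in_span, of "n - 1"] assms(2,3) by simp
qed

end
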